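(* Let $P$ be a Markov transition kernel on a finite state space $S$ with $|S|\ge 2$ and with a stationary distribution $\pi$ of full support. For any probability distribution $\mu$ on $S$, $$\Delta(\mu)=\sum_{x\in S}\mu(x)\,D_{\mathrm{KL}}\bigl(P(x,\cdot)\,\|\,\mu P\bigr)=I_\mu(X;Y).$$
   Context: All logarithms are natural, with $0\log 0=0$. For probability measures $\mu,\nu$ on $S$, $D_{\mathrm{KL}}(\mu\|\nu)=\sum_{x\in S}\mu(x)\log\frac{\mu(x)}{\nu(x)}$. $(\mu P)(y)=\sum_x\mu(x)P(x,y)$. The convexity gap of $\mu$ is $$\Delta(\mu):=\sum_{x\in S}\mu(x)\,D_{\mathrm{KL}}(P(x,\cdot)\|\pi)-D_{\mathrm{KL}}(\mu P\|\pi).$$ For $X\sim\mu$ and $Y\mid X=x\sim P(x,\cdot)$, the quantity $I_\mu(X;Y):=\sum_{x\in S}\mu(x)\,D_{\mathrm{KL}}(P(x,\cdot)\|\mu P)$ is the Shannon mutual information of $X$ and $Y$ under the joint distribution $\mu(x)P(x,y)$. *)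

theory Defs
  imports "HOL-Probability.Probability"
begin

text \<open>A finite state space is a type of class \<open>finite\<close>, probability distributions on it are
  \<open>pmf\<close>s, and a transition kernel \<open>P\<close> assigns to each state \<open>x\<close> the distribution \<open>P x\<close> of the
  next state.\<close>

text \<open>Where the first measure is not absolutely continuous with respect to the second, the
  divergence is \<open>\<infinity>\<close>. Otherwise it is the usual finite sum, in which a vanishing \<open>pmf \<mu> x\<close>
  annihilates its summand (\<open>0 log 0 = 0\<close>). The library's real-valued \<open>KL_divergence\<close> has
  an unspecified value in the former case.\<close>

definition kl_div :: "'a::finite pmf \<Rightarrow> 'a pmf \<Rightarrow> ereal" where
  "kl_div \<mu> \<nu> =
     (if set_pmf \<mu> \<subseteq> set_pmf \<nu>
      then ereal (\<Sum>x\<in>UNIV. pmf \<mu> x * ln (pmf \<mu> x / pmf \<nu> x))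
      else \<infinity>)"

definition step :: "'a pmf \<Rightarrow> ('a \<Rightarrow> 'a pmf) \<Rightarrow> 'a pmf" where
  "step \<mu> P = bind_pmf \<mu> P"

lemma pmf_step:
  fixes \<mu> :: "'a::finite pmf"
  shows "pmf (step \<mu> P) y = (\<Sum>x\<in>UNIV. pmf \<mu> x * pmf (P x) y)"
  by (simp add: step_def pmf_bind integral_measure_pmf[where A = UNIV])

definition stationary :: "('a \<Rightarrow> 'a pmf) \<Rightarrow> 'a pmf \<Rightarrow> bool" where
  "stationary P \<pi> \<longleftrightarrow> step \<pi> P = \<pi>"

text \<open>Below, as usual, \<open>0 * \<infinity> = 0\<close> in \<^typ>\<open>ereal\<close>: states of \<open>\<mu>\<close>-mass zero do not
  contribute. The difference is meaningful when \<open>\<pi>\<close> has full support, because then both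
  terms are finite.\<close>

definition convexity_gap :: "('a::finite \<Rightarrow> 'a pmf) \<Rightarrow> 'a pmf \<Rightarrow> 'a pmf \<Rightarrow> ereal" where
  "convexity_gap P \<pi> \<mu> =
     (\<Sum>x\<in>UNIV. ereal (pmf \<mu> x) * kl_div (P x) \<pi>) - kl_div (step \<mu> P) \<pi>"

text \<open>The law of \<open>(X, Y)\<close> for \<open>X\<close> distributed as \<open>\<mu>\<close> and \<open>Y\<close> given \<open>X = x\<close> distributed as \<open>P x\<close>.\<close>

definition joint_pmf :: "'a pmf \<Rightarrow> ('a \<Rightarrow> 'a pmf) \<Rightarrow> ('a \<times> 'a) pmf" where
  "joint_pmf \<mu> P = do {x \<leftarrow> \<mu>; y \<leftarrow> P x; return_pmf (x, y)}"

lemma pmf_joint_pmf: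
  fixes \<mu> :: "'a::finite pmf"
  shows "pmf (joint_pmf \<mu> P) (x, y) = pmf \<mu> x * pmf (P x) y"
proof -
  have "pmf (joint_pmf \<mu> P) (x, y) =
      (\<Sum>x'\<in>UNIV. pmf \<mu> x' * (\<Sum>y'\<in>UNIV. pmf (P x') y' * pmf (return_pmf (x', y')) (x, y)))"
    by (simp add: joint_pmf_def pmf_bind integral_measure_pmf[where A = UNIV] del: pmf_return)
  also have "\<dots> = (\<Sum>x'\<in>UNIV. if x' = x then pmf \<mu> x * pmf (P x) y else 0)"
  proof (rule sum.cong[OF refl])
    fix x' :: 'a
    have "(\<Sum>y'\<in>UNIV. pmf (P x') y' * pmf (return_pmf (x', y')) (x, y)) =
        (\<Sum>y'\<in>UNIV. if y' = y then (if x' = x then pmf (P x) y else 0) else 0)"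
      by (rule sum.cong) (auto simp: indicator_def)
    then show "pmf \<mu> x' * (\<Sum>y'\<in>UNIV. pmf (P x') y' * pmf (return_pmf (x', y')) (x, y)) =
        (if x' = x then pmf \<mu> x * pmf (P x) y else 0)"
      by simp
  qed
  finally show ?thesis
    by simp
qed

text \<open>The library's mutual information, with base \<open>exp 1\<close> for natural logarithms, of the two
  coordinates under the joint law.\<close>

definition mutual_info :: "'a pmf \<Rightarrow> ('a \<Rightarrow> 'a pmf) \<Rightarrow> real" where
  "mutual_info \<mu> P =
     prob_space.mutual_information (measure_pmf (joint_pmf \<mu> P)) (exp 1)
       (count_space UNIV) (count_space UNIV) fst snd"

end

theory Submission
  imports Defs
begin

text \<open>Since \<open>\<mu>P\<close> is the \<open>\<mu>\<close>-average of the rows \<open>P x\<close>, averaging the logarithm of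
  \<open>P x y / \<pi> y = (P x y / (\<mu>P) y) * ((\<mu>P) y / \<pi> y)\<close> against the joint law
  \<open>\<mu> x * P x y\<close> splits the mean divergence from \<open>\<pi>\<close> into the mean divergence from \<open>\<mu>P\<close> and
  the divergence of \<open>\<mu>P\<close> from \<open>\<pi>\<close>. The marginals of the joint law are \<open>\<mu>\<close> and \<open>\<mu>P\<close>, and
  \<open>P x y / (\<mu>P) y\<close> is its density with respect to the product of the marginals, so the mean
  divergence from \<open>\<mu>P\<close> is the mutual information.\<close>

lemma set_pmf_step: "set_pmf (step \<mu> P) = (\<Union>x\<in>set_pmf \<mu>. set_pmf (P x))"
  by (simp add: step_def)

lemma map_fst_joint_pmf: "map_pmf fst (joint_pmf \<mu> P) = \<mu>"
  by (simp add: joint_pmf_def map_bind_pmf map_pmf_comp bind_return_pmf' flip: map_pmf_def)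

lemma map_snd_joint_pmf: "map_pmf snd (joint_pmf \<mu> P) = step \<mu> P"
  by (simp add: joint_pmf_def step_def map_bind_pmf bind_return_pmf')

text \<open>Rows of positive mass have finite divergence by the assumption, and rows of mass zero
  contribute 0 even if theirs is infinite, so the mean is a real number.\<close>

lemma mean_kl_div:
  fixes P :: "'b::finite \<Rightarrow> 'a::finite pmf"
  assumes "\<And>x. x \<in> set_pmf \<mu> \<Longrightarrow> set_pmf (P x) \<subseteq> set_pmf \<nu>"
  shows "(\<Sum>x\<in>UNIV. ereal (pmf \<mu> x) * kl_div (P x) \<nu>) =
    ereal (\<Sum>x\<in>UNIV. \<Sum>y\<in>UNIV. pmf \<mu> x * pmf (P x) y * ln (pmf (P x) y / pmf \<nu> y))"
proof -
  have "ereal (pmf \<mu> x) * kl_div (P x) \<nu> =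
      ereal (\<Sum>y\<in>UNIV. pmf \<mu> x * pmf (P x) y * ln (pmf (P x) y / pmf \<nu> y))" for x
  proof (cases "x \<in> set_pmf \<mu>")
    case True
    then show ?thesis
      using assms by (simp add: kl_div_def sum_distrib_left mult.assoc)
  next
    case False
    then have "pmf \<mu> x = 0"
      by (simp add: set_pmf_iff)
    then show ?thesis
      by (simp flip: zero_ereal_def)
  qed
  then show ?thesis
    by simp
qed

lemma convexity_gap_eq_mean_kl_div:
  fixes P :: "'a::finite \<Rightarrow> 'a pmf"
  assumes ac: "\<And>x. x \<in> set_pmf \<mu> \<Longrightarrow> set_pmf (P x) \<subseteq> set_pmf \<pi>"
  shows "convexity_gap P \<pi> \<mu> = (\<Sum>x\<in>UNIV. ereal (pmf \<mu> x) * kl_div (P x) (step \<mu> P))"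
proof -
  let ?n = "pmf (step \<mu> P)"
  \<comment> \<open>Where the joint weight is positive, all three masses are positive and the
    logarithm splits; elsewhere every term has a factor 0.\<close>
  have split: "pmf \<mu> x * pmf (P x) y * ln (pmf (P x) y / pmf \<pi> y) =
      pmf \<mu> x * pmf (P x) y * ln (pmf (P x) y / ?n y) + pmf \<mu> x * pmf (P x) y * ln (?n y / pmf \<pi> y)"
    for x y
  proof (cases "x \<in> set_pmf \<mu> \<and> y \<in> set_pmf (P x)")
    case True
    then have "y \<in> set_pmf (step \<mu> P)" "y \<in> set_pmf \<pi>"
      using ac by (auto simp: set_pmf_step)
    then have "pmf (P x) y > 0" "?n y > 0" "pmf \<pi> y > 0"
      using True by (simp_all add: pmf_positive)
    then show ?thesis
      by (simp add: ln_div algebra_simps)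
  qed (auto simp: set_pmf_iff)
  \<comment> \<open>This logarithm does not depend on \<open>x\<close>, so summing over
    \<open>x\<close> first leaves the second marginal as weight.\<close>
  have "(\<Sum>x\<in>UNIV. \<Sum>y\<in>UNIV. pmf \<mu> x * pmf (P x) y * ln (?n y / pmf \<pi> y)) =
      (\<Sum>y\<in>UNIV. ?n y * ln (?n y / pmf \<pi> y))"
    by (subst sum.swap) (simp add: pmf_step sum_distrib_right)
  moreover have "set_pmf (step \<mu> P) \<subseteq> set_pmf \<pi>"
    using ac by (auto simp: set_pmf_step)
  ultimately have kl_step: "kl_div (step \<mu> P) \<pi> =
      ereal (\<Sum>x\<in>UNIV. \<Sum>y\<in>UNIV. pmf \<mu> x * pmf (P x) y * ln (?n y / pmf \<pi> y))"
    by (simp add: kl_div_def)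
  have "\<And>x. x \<in> set_pmf \<mu> \<Longrightarrow> set_pmf (P x) \<subseteq> set_pmf (step \<mu> P)"
    by (auto simp: set_pmf_step)
  \<comment> \<open>All three divergence terms are now real, so the difference in
    \<open>ereal\<close> is an ordinary cancellation.\<close>
  from mean_kl_div[of \<mu> P, OF this] mean_kl_div[of \<mu> P, OF ac] show ?thesis
    unfolding convexity_gap_def kl_step by (simp add: split sum.distrib)
qed

lemma mutual_info_eq_sum:
  fixes P :: "'a::finite \<Rightarrow> 'a pmf"
  shows "mutual_info \<mu> P =
    (\<Sum>x\<in>UNIV. \<Sum>y\<in>UNIV. pmf \<mu> x * pmf (P x) y * ln (pmf (P x) y / pmf (step \<mu> P) y))"
proof -
  let ?M = "measure_pmf (joint_pmf \<mu> P)"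
  interpret information_space ?M "exp 1"
    by unfold_locales simp
  have X: "simple_distributed ?M fst (pmf \<mu>)"
  proof (rule measure_pmf.simple_distributedI)
    show "pmf \<mu> x = measure ?M (fst -` {x} \<inter> space ?M)" for x
      \<comment> \<open>Only the \<open>\<mu>\<close> on the left is rewritten: the marginal itself
        contains \<open>\<mu>\<close>, so as a simp rule the equation would loop.\<close>
      by (subst (1) map_fst_joint_pmf[of \<mu> P, symmetric]) (simp only: pmf_map space_measure_pmf Int_UNIV_right)
  qed (auto simp: simple_function_def)
  have Y: "simple_distributed ?M snd (pmf (step \<mu> P))"
  proof (rule measure_pmf.simple_distributedI)
    show "pmf (step \<mu> P) y = measure ?M (snd -` {y} \<inter> space ?M)" for y
      by (simp add: pmf_map flip: map_snd_joint_pmf)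
  qed (auto simp: simple_function_def)
  \<comment> \<open>The identity is written as a pair of coordinates to match the library formula
    for mutual information.\<close>
  have XY: "simple_distributed ?M (\<lambda>z. (fst z, snd z)) (pmf (joint_pmf \<mu> P))"
  proof (rule measure_pmf.simple_distributedI)
    show "pmf (joint_pmf \<mu> P) z = measure ?M ((\<lambda>z. (fst z, snd z)) -` {z} \<inter> space ?M)" for z
      by (simp add: measure_pmf_single)
  qed (auto simp: simple_function_def)
  have "mutual_info \<mu> P = (\<Sum>(x, y)\<in>UNIV. pmf \<mu> x * pmf (P x) y *
      ln (pmf \<mu> x * pmf (P x) y / (pmf \<mu> x * pmf (step \<mu> P) y)))"
    using mutual_information_simple_distributed[OF X Y XY]
    by (simp add: mutual_info_def log_def pmf_joint_pmf)
  \<comment> \<open>The factor \<open>pmf \<mu> x\<close> cancels in the quotient unless it is 0,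
    and then the summand vanishes anyway.\<close>
  also have "\<dots> = (\<Sum>(x, y)\<in>UNIV. pmf \<mu> x * pmf (P x) y * ln (pmf (P x) y / pmf (step \<mu> P) y))"
    by (rule sum.cong) auto
  finally show ?thesis
    by (simp add: sum.cartesian_product)
qed

theorem theorem7p3:
  fixes P :: "'a::finite \<Rightarrow> 'a pmf" and \<pi> \<mu> :: "'a pmf"
  assumes "CARD('a) \<ge> 2"
    and "stationary P \<pi>"
    and "set_pmf \<pi> = UNIV"
  shows "convexity_gap P \<pi> \<mu> = (\<Sum>x\<in>UNIV. ereal (pmf \<mu> x) * kl_div (P x) (step \<mu> P))
    \<and> (\<Sum>x\<in>UNIV. ereal (pmf \<mu> x) * kl_div (P x) (step \<mu> P)) = ereal (mutual_info \<mu> P)"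
proof
  show "convexity_gap P \<pi> \<mu> = (\<Sum>x\<in>UNIV. ereal (pmf \<mu> x) * kl_div (P x) (step \<mu> P))"
    using assms(3) by (intro convexity_gap_eq_mean_kl_div) simp
  show "(\<Sum>x\<in>UNIV. ereal (pmf \<mu> x) * kl_div (P x) (step \<mu> P)) = ereal (mutual_info \<mu> P)"
    unfolding mutual_info_eq_sum by (rule mean_kl_div) (auto simp: set_pmf_step)
qed

end
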